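(* The formulation $\mathrm{AF}_{\mathrm{ca}}$ models the CBPP. That is, for every instance of the CBPP and every nonnegative integer $\bar z$, there is a feasible solution of the CBPP instance using exactly $\bar z$ bins if and only if there is a feasible (integer) solution $(\bar x,\bar z)$ of the corresponding formulation $\mathrm{AF}_{\mathrm{ca}}$; in particular the two problems have the same optimal value.
   Context: Notation: $[k]=\{1,\dots,k\}$. An instance of the Colored Bin Packing Problem (CBPP) consists of an integer bin capacity $L>0$, an integer number of colors $Q\ge 2$, and a set $\mathcal{I}=[m]$ of items, each item $u$ having an integer length $l_u>0$, an integer demand $d_u>0$ and a color $c_u\in[Q]$; all (length, color) pairs are distinct in $\mathcal{I}$. Let $\mathcal{I}'$ consist of $d_u$ copies of each $u\in\mathcal{I}$ (with the same length and color). A feasible solution is a partition of $\mathcal{I}'$ into (nonempty) parts, called bins, such that in each part the total length is at most $L$ and the part has an ordering in which no two consecutive items have the same color. The objective is to minimize the number of parts. Formulation $\mathrm{AF}_{\mathrm{ca}}$ uses a directed multigraph $G=(V,A)$ with color-labeled arcs: $V=\{0,1,\dots,L\}$, and $A=A_1\cup\dots\cup A_Q\cup A_{Q+1}$, where for $q\in[Q]$, $A_q=\{(i,j,q):0\le i\le j\le L,\ \exists u\in\mathcal{I}: l_u=j-i,\ c_u=q\}$, and $A_{Q+1}=\{(i,L,Q+1):1\le i\le L-1\}$ (loss-arcs). Here $(i,j,q)$ is an arc from $i$ to $j$ with color $q$. The variables are $z$ and $x_{ijq}$ for $(i,j,q)\in A$, all nonnegative integers; the objective is to minimize $z$ subject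 to: (Flow) for every $j\in V$, $\sum_{(i,j,q)\in A}x_{ijq}-\sum_{(j,k,q')\in A}x_{jkq'}$ (sums over all arcs entering, resp. leaving, $j$) equals $-z$ if $j=0$, $0$ if $1\le j\le L-1$, and $z$ if $j=L$; (Color) for every $j\in\{1,\dots,L-1\}$ and every fixed $q\in[Q]$, $\sum_{i:(i,j,q)\in A}x_{ijq}\le\sum_{(j,k,q')\in A,\ q'\in[Q+1]\setminus\{q\}}x_{jkq'}$; (Demand) for every $u\in\mathcal{I}$, $\sum_{(i,j,q)\in A:\ j=i+l_u,\ q=c_u}x_{ijq}=d_u$ (for an item $u$ with no arcs of length $l_u$ and color $c_u$, the left side is $0$). *)

theory Defs
  imports Main "HOL-Library.Disjoint_Sets" "HOL-Library.Extended_Nat"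
begin

record cbpp =
  capacity :: nat
  num_colors :: nat
  num_items :: nat
  item_length :: "nat \<Rightarrow> nat"
  item_demand :: "nat \<Rightarrow> nat"
  item_color :: "nat \<Rightarrow> nat"

definition items :: "cbpp \<Rightarrow> nat set" where
  "items I = {1..num_items I}"

definition cbpp_instance :: "cbpp \<Rightarrow> bool" where
  "cbpp_instance I \<longleftrightarrow>
     capacity I > 0 \<and> num_colors I \<ge> 2 \<and>
     (\<forall>u\<in>items I. item_length I u > 0 \<and> item_demand I u > 0 \<and>
        item_color I u \<in> {1..num_colors I}) \<and>
     inj_on (\<lambda>u. (item_length I u, item_color I u)) (items I)"

(* The pair (u, k) is the k-th copy of item u. *)
definition item_copies :: "cbpp \<Rightarrow> (nat \<times> nat) set" where
  "item_copies I = (SIGMA u:items I. {1..item_demand I u})"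

definition feasible_bin :: "cbpp \<Rightarrow> (nat \<times> nat) set \<Rightarrow> bool" where
  "feasible_bin I S \<longleftrightarrow>
     (\<Sum>(u, k)\<in>S. item_length I u) \<le> capacity I \<and>
     (\<exists>xs. distinct xs \<and> set xs = S \<and>
        successively (\<lambda>(u, k) (v, k'). item_color I u \<noteq> item_color I v) xs)"

(* partition_on requires the parts to be nonempty. *)
definition cbpp_solution :: "cbpp \<Rightarrow> (nat \<times> nat) set set \<Rightarrow> bool" where
  "cbpp_solution I B \<longleftrightarrow> partition_on (item_copies I) B \<and> (\<forall>S\<in>B. feasible_bin I S)"

(* The infimum is \<infinity> if there is no feasible solution; likewise for af_opt below. *)
definition cbpp_opt :: "cbpp \<Rightarrow> enat" where
  "cbpp_opt I = (INF B\<in>{B. cbpp_solution I B}. enat (card B))"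

(* The triple (i, j, q) is an arc from i to j with color q. *)
type_synonym arc = "nat \<times> nat \<times> nat"

definition color_arcs :: "cbpp \<Rightarrow> nat \<Rightarrow> arc set" where
  "color_arcs I q =
     {(i, j, q) | i j. i \<le> j \<and> j \<le> capacity I \<and>
        (\<exists>u\<in>items I. item_length I u = j - i \<and> item_color I u = q)}"

definition loss_arcs :: "cbpp \<Rightarrow> arc set" where
  "loss_arcs I = {(i, capacity I, num_colors I + 1) | i. 1 \<le> i \<and> i \<le> capacity I - 1}"

definition arcs :: "cbpp \<Rightarrow> arc set" where
  "arcs I = (\<Union>q\<in>{1..num_colors I}. color_arcs I q) \<union> loss_arcs I"

definition flow_constraints :: "cbpp \<Rightarrow> (arc \<Rightarrow> nat) \<Rightarrow> nat \<Rightarrow> bool" where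
  "flow_constraints I x z \<longleftrightarrow>
     (\<forall>v\<in>{0..capacity I}.
        int (\<Sum>a\<in>{(i, j, q) \<in> arcs I. j = v}. x a)
          - int (\<Sum>a\<in>{(i, j, q) \<in> arcs I. i = v}. x a)
        = (if v = 0 then - int z else if v = capacity I then int z else 0))"

definition color_constraints :: "cbpp \<Rightarrow> (arc \<Rightarrow> nat) \<Rightarrow> bool" where
  "color_constraints I x \<longleftrightarrow>
     (\<forall>v\<in>{1..capacity I - 1}. \<forall>p\<in>{1..num_colors I}.
        (\<Sum>a\<in>{(i, j, q) \<in> arcs I. j = v \<and> q = p}. x a)
        \<le> (\<Sum>a\<in>{(i, j, q) \<in> arcs I. i = v \<and> q \<in> {1..num_colors I + 1} - {p}}. x a))"

definition demand_constraints :: "cbpp \<Rightarrow> (arc \<Rightarrow> nat) \<Rightarrow> bool" where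
  "demand_constraints I x \<longleftrightarrow>
     (\<forall>u\<in>items I.
        (\<Sum>a\<in>{(i, j, q) \<in> arcs I. j = i + item_length I u \<and> q = item_color I u}. x a)
        = item_demand I u)"

(* Only the values of x on arcs I are constrained; all other values are irrelevant. *)
definition af_feasible :: "cbpp \<Rightarrow> (arc \<Rightarrow> nat) \<Rightarrow> nat \<Rightarrow> bool" where
  "af_feasible I x z \<longleftrightarrow>
     flow_constraints I x z \<and> color_constraints I x \<and> demand_constraints I x"

definition af_opt :: "cbpp \<Rightarrow> enat" where
  "af_opt I = (INF (x, z)\<in>{(x, z). af_feasible I x z}. enat z)"

end

theory Submission
  imports Defs "HOL-Combinatorics.Transposition"
begin

text \<open>A bin is a path from \<open>0\<close> to \<open>L\<close> whose item arcs change color at every inner vertex, closed by a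
  loss arc if the bin is not full; superposing the paths of all bins gives a solution of the
  formulation. Conversely, sweep over the vertices \<open>v = 0, \<dots>, L - 1\<close>. The bins currently ending at
  \<open>v\<close> are as many as the units of flow leaving \<open>v\<close>, by flow conservation, and must be matched
  bijectively with them so that colors differ. The color constraints are exactly what this needs:
  in a bijection with the fewest color clashes, any clash could be removed by a swap.\<close>

section \<open>Matchings of labelled finite sets, and counting along lists\<close>

text \<open>Fibres over the same label have equal size, so bijections between them exist and glue
  together. This later assigns concrete copies to the occurrences of an item.\<close>

lemma ex_bij_betw_fibres:
  assumes "finite A" "finite B"
    and card: "\<And>y. card {a \<in> A. f a = y} = card {b \<in> B. g b = y}"
  shows "\<exists>h. bij_betw h A B \<and> (\<forall>a\<in>A. g (h a) = f a)"
proof -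
  have "\<exists>h. bij_betw h {a \<in> A. f a = y} {b \<in> B. g b = y}" for y
    using assms by (intro finite_same_card_bij) auto
  then obtain H where H: "\<And>y. bij_betw (H y) {a \<in> A. f a = y} {b \<in> B. g b = y}"
    by metis
  define h where "h a = H (f a) a" for a
  have in_B: "h a \<in> B" and label: "g (h a) = f a" if "a \<in> A" for a
    using bij_betwE[OF H[of "f a"]] that unfolding h_def by blast+
  have "inj_on h A"
  proof
    fix a a' assume a: "a \<in> A" "a' \<in> A" "h a = h a'"
    then have "f a = f a'" using label by metis
    then show "a = a'"
      using a bij_betw_imp_inj_on[OF H[of "f a"]] by (auto simp: h_def inj_on_def)
  qed
  moreover have "b \<in> h ` A" if "b \<in> B" for b
  proof -
    have "b \<in> H (g b) ` {a \<in> A. f a = g b}"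
      using bij_betw_imp_surj_on[OF H[of "g b"]] that by blast
    then show ?thesis by (force simp: h_def)
  qed
  ultimately show ?thesis
    using in_B label by (auto simp: bij_betw_def)
qed

lemma ex_bij_betw_avoiding_label:
  fixes f :: "'a \<Rightarrow> 'c" and g :: "'b \<Rightarrow> 'c"
  assumes fin: "finite A" "finite B" and "card A = card B"
    and le: "\<And>y. card {a \<in> A. f a = y} \<le> card {b \<in> B. g b \<noteq> y}"
  shows "\<exists>h. bij_betw h A B \<and> (\<forall>a\<in>A. g (h a) \<noteq> f a)"
proof -
  define conflicts where "conflicts h = {a \<in> A. g (h a) = f a}" for h
  obtain h0 where "bij_betw h0 A B"
    using finite_same_card_bij assms(1-3) by blast
  then obtain h where h: "bij_betw h A B"
    and min: "\<And>h'. bij_betw h' A B \<Longrightarrow> card (conflicts h) \<le> card (conflicts h')"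
    using ex_has_least_nat[of "\<lambda>h. bij_betw h A B" h0 "\<lambda>h. card (conflicts h)"] by blast
  have "g (h a) \<noteq> f a" if a: "a \<in> A" for a
  proof
    assume conflict: "g (h a) = f a"
    \<comment> \<open>Look for a swap partner. If there were none, every \<open>b\<close> whose
      label differs from \<open>f a\<close> would be the image of an element of the fibre of
      \<open>f a\<close> other than \<open>a\<close>. That is at most the size of this fibre minus
      one, against \<open>le\<close>.\<close>
    have "\<exists>a'\<in>A. f a' \<noteq> f a \<and> g (h a') \<noteq> f a"
    proof (rule ccontr)
      assume none: "\<not> ?thesis"
      have "{b \<in> B. g b \<noteq> f a} \<subseteq> h ` ({a' \<in> A. f a' = f a} - {a})"
      proof
        fix b assume b: "b \<in> {b \<in> B. g b \<noteq> f a}"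
        then obtain a' where a': "a' \<in> A" "b = h a'"
          using h by (auto simp: bij_betw_def)
        then have "f a' = f a" "a' \<noteq> a" using none b conflict by auto
        then show "b \<in> h ` ({a' \<in> A. f a' = f a} - {a})" using a' by blast
      qed
      then have "card {b \<in> B. g b \<noteq> f a} \<le> card (h ` ({a' \<in> A. f a' = f a} - {a}))"
        by (intro card_mono) (use fin in auto)
      also have "\<dots> \<le> card ({a' \<in> A. f a' = f a} - {a})"
        by (intro card_image_le) (use fin in auto)
      also have "\<dots> < card {a' \<in> A. f a' = f a}"
        by (intro card_Diff1_less) (use fin a in auto)
      finally show False using le[of "f a"] by simp
    qed
    then obtain a' where a': "a' \<in> A" "f a' \<noteq> f a" "g (h a') \<noteq> f a" by blast
    define h' where "h' = h \<circ> transpose a a'"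
    have "bij_betw (transpose a a') A A"
      using a a'(1) by simp
    then have "bij_betw h' A B"
      unfolding h'_def using h by (rule bij_betw_trans)
    \<comment> \<open>The swap gives \<open>a\<close> the value \<open>h a'\<close>, whose label is
      not \<open>f a\<close>, and gives \<open>a'\<close> the value \<open>h a\<close>, whose label
      is \<open>f a\<close> and hence not \<open>f a'\<close>. The conflict at \<open>a\<close>
      disappears and none is created.\<close>
    moreover have "conflicts h' \<subseteq> conflicts h - {a}"
      using a' conflict by (auto simp: conflicts_def h'_def transpose_def split: if_splits)
    then have "card (conflicts h') \<le> card (conflicts h - {a})"
      by (intro card_mono) (use fin in \<open>auto simp: conflicts_def\<close>)
    moreover have "card (conflicts h - {a}) < card (conflicts h)"
      by (intro card_Diff1_less) (use fin a conflict in \<open>auto simp: conflicts_def\<close>)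
    ultimately show False using min[of h'] by simp
  qed
  with h show ?thesis by blast
qed

text \<open>Turns the sums in the constraints into counts along a path, which can be handled by
  induction on the path.\<close>

lemma sum_count_list_filter:
  assumes "finite A" "set as \<subseteq> A"
  shows "(\<Sum>a\<in>{(i, j, q) \<in> A. \<phi> i j q}. count_list as a)
    = length (filter (\<lambda>a. \<phi> (fst a) (fst (snd a)) (snd (snd a))) as)"
  using assms(2)
proof (induction as)
  case (Cons b as)
  let ?S = "{(i, j, q). (i, j, q) \<in> A \<and> \<phi> i j q}"
  have fin: "finite ?S"
    by (rule finite_subset[OF _ assms(1)]) auto
  have "(\<Sum>a\<in>?S. count_list (b # as) a) = (\<Sum>a\<in>?S. count_list as a + (if b = a then 1 else 0))"
    by (intro sum.cong) auto
  also have "\<dots> = (\<Sum>a\<in>?S. count_list as a) + (if b \<in> ?S then 1 else 0)"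
    using fin by (simp add: sum.distrib)
  finally show ?case using Cons by auto
qed simp

locale colored_bin_packing =
  fixes I :: cbpp
  assumes inst: "cbpp_instance I"
begin

abbreviation "L \<equiv> capacity I"
abbreviation "Q \<equiv> num_colors I"
abbreviation "len \<equiv> item_length I"
abbreviation "col \<equiv> item_color I"

lemma L_pos: "L > 0" and len_pos: "u \<in> items I \<Longrightarrow> len u > 0"
  and col_ge_1: "u \<in> items I \<Longrightarrow> 1 \<le> col u" and col_le_Q: "u \<in> items I \<Longrightarrow> col u \<le> Q"
  and item_eqI: "\<lbrakk>u \<in> items I; v \<in> items I; len u = len v; col u = col v\<rbrakk> \<Longrightarrow> u = v"
  using inst by (auto simp: cbpp_instance_def inj_on_def)

lemma arcs_iff:
  "(i, j, q) \<in> arcs I \<longleftrightarrow>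
    (i \<le> j \<and> j \<le> L \<and> (\<exists>u\<in>items I. len u = j - i \<and> col u = q)) \<or>
    (1 \<le> i \<and> i < L \<and> j = L \<and> q = Q + 1)"
  using col_ge_1 col_le_Q by (auto simp: arcs_def color_arcs_def loss_arcs_def)

text \<open>Positive item lengths make every arc point strictly upward. This acyclicity is what
  permits a sweep over the vertices in increasing order.\<close>

lemma arcs_bounds:
  assumes "(i, j, q) \<in> arcs I"
  shows "i < j" "i < L" "j \<le> L" "1 \<le> q" "q \<le> Q + 1"
  using assms len_pos col_ge_1 col_le_Q by (fastforce simp: arcs_iff)+

lemma finite_arcs: "finite (arcs I)"
proof (rule finite_subset)
  show "arcs I \<subseteq> {..L} \<times> {..L} \<times> {..Q + 1}"
    using arcs_bounds by fastforce
qed simp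

section \<open>Packings as a link between bins and flows\<close>

text \<open>A bin in a fixed order with the copy numbers forgotten: lengths, colors and arcs depend
  on the item alone.\<close>

definition packing :: "nat list \<Rightarrow> bool" where
  "packing us \<longleftrightarrow> set us \<subseteq> items I \<and> sum_list (map len us) \<le> L \<and>
     successively (\<lambda>u v. col u \<noteq> col v) us"

text \<open>An indexed family, since different bins may become the same list once copy numbers are
  forgotten.\<close>

definition packing_family :: "nat \<Rightarrow> (nat \<Rightarrow> nat list) \<Rightarrow> bool" where
  "packing_family z P \<longleftrightarrow> (\<forall>k<z. packing (P k) \<and> P k \<noteq> []) \<and>
     (\<forall>u\<in>items I. (\<Sum>k<z. count_list (P k) u) = item_demand I u)"

lemma feasible_bin_iff:
  assumes "S \<subseteq> item_copies I"
  shows "feasible_bin I S \<longleftrightarrow> (\<exists>xs. distinct xs \<and> set xs = S \<and> packing (map fst xs))"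
proof -
  have "successively (\<lambda>(u, k) (v, k'). col u \<noteq> col v) xs
      \<longleftrightarrow> successively (\<lambda>u v. col u \<noteq> col v) (map fst xs)" for xs :: "(nat \<times> nat) list"
    by (simp add: successively_map case_prod_unfold)
  moreover have "(\<Sum>(u, k)\<in>S. len u) = sum_list (map len (map fst xs))"
    if "distinct xs" "set xs = S" for xs
    using that by (auto simp: sum_list_distinct_conv_sum_set case_prod_unfold o_def)
  moreover have "fst ` S \<subseteq> items I"
    using assms by (auto simp: item_copies_def)
  ultimately show ?thesis
    by (auto simp: feasible_bin_def packing_def) 
qed

lemma finite_item_copies: "finite (item_copies I)"
  by (auto simp: item_copies_def items_def)

lemma count_list_map_fst:
  assumes "distinct xs"
  shows "count_list (map fst xs) u = card {c \<in> set xs. fst c = u}"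
  using assms
proof (induction xs)
  case (Cons c xs)
  have "{c' \<in> set (c # xs). fst c' = u}
      = (if fst c = u then insert c {c \<in> set xs. fst c = u} else {c \<in> set xs. fst c = u})"
    by auto
  then show ?case using Cons by simp
qed simp

text \<open>Order each bin and drop the copy numbers. As the bins are disjoint and cover all copies,
  the occurrences of an item add up to its demand.\<close>

lemma solution_imp_packing_family:
  assumes "cbpp_solution I B"
  shows "\<exists>P. packing_family (card B) P"
proof -
  have part: "partition_on (item_copies I) B"
    using assms by (simp add: cbpp_solution_def)
  have "finite B"
    using finite_elements[OF finite_item_copies part] .
  then obtain h where h: "bij_betw h {..<card B} B"
    using ex_bij_betw_nat_finite[of B] by (auto simp: atLeast0LessThan)
  have "\<exists>xs. distinct xs \<and> set xs = S \<and> packing (map fst xs)" if "S \<in> B" for S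
    using feasible_bin_iff[of S] assms that partition_onD1[OF part]
    by (auto simp: cbpp_solution_def)
  then obtain ord where ord: "\<And>S. S \<in> B \<Longrightarrow> distinct (ord S)"
    "\<And>S. S \<in> B \<Longrightarrow> set (ord S) = S" "\<And>S. S \<in> B \<Longrightarrow> packing (map fst (ord S))"
    by metis
  define P where "P k = map fst (ord (h k))" for k
  have hB: "h k \<in> B" if "k < card B" for k
    using bij_betwE[OF h] that by simp
  have "packing (P k)" if "k < card B" for k
    using hB[OF that] ord(3) by (simp add: P_def)
  moreover have "P k \<noteq> []" if "k < card B" for k
    using hB[OF that] ord(2)[of "h k"] partition_onD3[OF part] by (auto simp: P_def)
  moreover have "(\<Sum>k<card B. count_list (P k) u) = item_demand I u" if u: "u \<in> items I" for u
  proof -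
    have "(\<Sum>k<card B. count_list (P k) u) = (\<Sum>S\<in>B. card {c \<in> S. fst c = u})"
      unfolding sum.reindex_bij_betw[OF h, symmetric]
      by (intro sum.cong refl) (auto simp: P_def count_list_map_fst ord hB)
    also have "\<dots> = card (\<Union>S\<in>B. {c \<in> S. fst c = u})"
    proof (rule card_UN_disjoint[symmetric])
      show "\<forall>S\<in>B. finite {c \<in> S. fst c = u}"
        using partition_onD1[OF part] finite_item_copies by (auto intro: finite_subset)
      show "\<forall>S\<in>B. \<forall>T\<in>B. S \<noteq> T \<longrightarrow> {c \<in> S. fst c = u} \<inter> {c \<in> T. fst c = u} = {}"
        using partition_onD2[OF part] by (auto simp: disjoint_def)
    qed fact
    also have "(\<Union>S\<in>B. {c \<in> S. fst c = u}) = {u} \<times> {1..item_demand I u}"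
    proof -
      have "(\<Union>S\<in>B. {c \<in> S. fst c = u}) = {c. c \<in> \<Union>B \<and> fst c = u}"
        by (simp add: set_eq_iff)
      also have "\<dots> = {u} \<times> {1..item_demand I u}"
        unfolding partition_onD1[OF part, symmetric] using u by (auto simp: item_copies_def)
      finally show ?thesis .
    qed
    finally show ?thesis by (simp add: card_cartesian_product)
  qed
  ultimately have "packing_family (card B) P"
    by (simp add: packing_family_def)
  then show ?thesis by (rule exI[of _ P])
qed

text \<open>The positions \<open>(k, n)\<close> in the lists that hold an item are as many as its
  copies, so a bijection can give each position its own copy. The bins are the images of the
  lists.\<close>

lemma packing_family_imp_solution:
  assumes P: "packing_family z P"
  shows "\<exists>B. cbpp_solution I B \<and> card B = z"
proof -
  define slots where "slots = (SIGMA k:{..<z}. {..<length (P k)})"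
  have "card {s \<in> slots. (case s of (k, n) \<Rightarrow> P k ! n) = u} = card {c \<in> item_copies I. fst c = u}" for u
  proof -
    have "{s \<in> slots. (case s of (k, n) \<Rightarrow> P k ! n) = u}
        = (SIGMA k:{..<z}. {n. n < length (P k) \<and> P k ! n = u})"
      by (auto simp: slots_def)
    then have eq: "card {s \<in> slots. (case s of (k, n) \<Rightarrow> P k ! n) = u}
        = (\<Sum>k<z. count_list (P k) u)"
      by (simp add: card_SigmaI count_list_eq_length_filter length_filter_conv_card eq_commute)
    show ?thesis
    proof (cases "u \<in> items I")
      case True
      then have "{c \<in> item_copies I. fst c = u} = {u} \<times> {1..item_demand I u}"
        by (auto simp: item_copies_def)
      with eq P True show ?thesis by (simp add: packing_family_def card_cartesian_product)
    next
      case False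
      then have "card {c \<in> item_copies I. fst c = u} = 0"
        by (auto simp: item_copies_def card_eq_0_iff)
      moreover have "count_list (P k) u = 0" if "k < z" for k
        using P False that by (auto simp: packing_family_def packing_def count_list_0_iff)
      ultimately show ?thesis using eq by simp
    qed
  qed
  then have "\<exists>g. bij_betw g slots (item_copies I) \<and>
      (\<forall>s\<in>slots. fst (g s) = (case s of (k, n) \<Rightarrow> P k ! n))"
    using finite_item_copies by (intro ex_bij_betw_fibres) (auto simp: slots_def)
  then obtain g where g: "bij_betw g slots (item_copies I)"
    and fst_g: "\<And>k n. (k, n) \<in> slots \<Longrightarrow> fst (g (k, n)) = P k ! n"
    by fastforce
  have inj: "inj_on g slots" and img: "g ` slots = item_copies I"
    using g by (auto simp: bij_betw_def)
  define bin where "bin k = (\<lambda>n. g (k, n)) ` {..<length (P k)}" for k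
  have bin_ne: "bin k \<noteq> {}" if "k < z" for k
    using P that by (auto simp: bin_def packing_family_def)
  have bin_disj: "bin k \<inter> bin k' = {}" if "k < z" "k' < z" "k \<noteq> k'" for k k'
    using inj that by (force simp: bin_def slots_def inj_on_def)
  \<comment> \<open>Disjoint nonempty sets differ, so even equal lists yield different parts and
    their number is exactly \<open>z\<close>.\<close>
  have "inj_on bin {..<z}"
    using bin_ne bin_disj by (fastforce simp: inj_on_def)
  then have "card (bin ` {..<z}) = z" by (simp add: card_image)
  moreover have UN: "(\<Union>k<z. bin k) = item_copies I"
    using img by (force simp: bin_def slots_def)
  then have "partition_on (item_copies I) (bin ` {..<z})"
  proof (intro partition_onI)
    fix S T assume "S \<in> bin ` {..<z}" "T \<in> bin ` {..<z}" "S \<noteq> T"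
    then show "disjnt S T" using bin_disj unfolding disjnt_def by blast
  next
    show "{} \<notin> bin ` {..<z}" using bin_ne by fastforce
  qed
  moreover have "feasible_bin I (bin k)" if k: "k < z" for k
  proof -
    let ?xs = "map (\<lambda>n. g (k, n)) [0..<length (P k)]"
    have "inj_on (\<lambda>n. g (k, n)) {..<length (P k)}"
      using inj k by (auto simp: inj_on_def slots_def)
    then have "distinct ?xs" by (simp add: distinct_map atLeast0LessThan)
    moreover have "set ?xs = bin k" by (simp add: bin_def atLeast0LessThan)
    moreover have "map fst ?xs = P k"
      using k by (intro nth_equalityI) (auto simp: fst_g slots_def)
    moreover have "bin k \<subseteq> item_copies I" using UN k by blast
    ultimately show ?thesis
      using P k feasible_bin_iff[of "bin k"] by (metis packing_family_def)
  qed
  ultimately show ?thesis by (auto simp: cbpp_solution_def)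
qed

section \<open>From packings to flows: superposed paths\<close>

fun path_arcs :: "nat \<Rightarrow> nat list \<Rightarrow> arc list" where
  "path_arcs i [] = (if i < L then [(i, L, Q + 1)] else [])"
| "path_arcs i (u # us) = (i, i + len u, col u) # path_arcs (i + len u) us"

text \<open>The last assumption excludes the empty list at vertex 0: it would call for a loss arc
  leaving 0, and there is none.\<close>

lemma path_arcs_subset:
  assumes "set us \<subseteq> items I" "i + sum_list (map len us) \<le> L" "1 \<le> i \<or> us \<noteq> []"
  shows "set (path_arcs i us) \<subseteq> arcs I"
  using assms
proof (induction us arbitrary: i)
  case (Cons u us)
  then have "set (path_arcs (i + len u) us) \<subseteq> arcs I"
    using len_pos[of u] by (intro Cons.IH) auto
  then show ?case using Cons.prems by (auto simp: arcs_iff)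
qed (auto simp: arcs_iff)

text \<open>Inflow minus outflow of a path is -1 at its start and 1 at \<open>L\<close>, written
  without subtraction. In the induction the head arc moves the start indicator from \<open>i\<close>
  to \<open>i + len u\<close>.\<close>

lemma path_arcs_flow:
  assumes "i + sum_list (map len us) \<le> L"
  shows "length (filter (\<lambda>a. fst (snd a) = v) (path_arcs i us)) + (if v = i then 1 else 0)
    = length (filter (\<lambda>a. fst a = v) (path_arcs i us)) + (if v = L then 1 else 0)"
  using assms
proof (induction us arbitrary: i)
  case (Cons u us)
  from Cons.prems show ?case using Cons.IH[of "i + len u"] by (auto split: if_splits)
qed auto

text \<open>In the induction, \<open>p\<close> is the color of the arc along which the path has reached \<open>i\<close>;
  at the start of a path it can be any value that is not a color.\<close>
lemma path_arcs_color:
  assumes "set us \<subseteq> items I" "i + sum_list (map len us) \<le> L" "successively (\<lambda>u v. col u \<noteq> col v) us"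
    and "us = [] \<or> p \<noteq> col (hd us)" "v < L" "q \<in> {1..Q}"
  shows "length (filter (\<lambda>a. fst (snd a) = v \<and> snd (snd a) = q) (path_arcs i us))
      + (if v = i \<and> p = q then 1 else 0)
    \<le> length (filter (\<lambda>a. fst a = v \<and> snd (snd a) \<in> {1..Q + 1} - {q}) (path_arcs i us))"
  using assms
proof (induction us arbitrary: i p)
  case (Cons u us)
  \<comment> \<open>If the indicator for \<open>p\<close> counts, the head arc leaves
    \<open>i\<close> in a color other than \<open>p\<close> and pays for it. What the head arc adds
    on the left at \<open>i + len u\<close> is exactly the indicator in the induction
    hypothesis.\<close>
  then have "length (filter (\<lambda>a. fst (snd a) = v \<and> snd (snd a) = q) (path_arcs (i + len u) us))
      + (if v = i + len u \<and> col u = q then 1 else 0)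
    \<le> length (filter (\<lambda>a. fst a = v \<and> snd (snd a) \<in> {1..Q + 1} - {q}) (path_arcs (i + len u) us))"
    by (intro Cons.IH) (auto simp: successively_Cons)
  then show ?case
    using Cons.prems col_ge_1[of u] col_le_Q[of u] by (auto split: if_splits)
qed auto

text \<open>Length and color determine an item, so an item arc on the path is counted only for its
  own item; the loss arc never is, its color being \<open>Q + 1\<close>.\<close>

lemma path_arcs_demand:
  assumes "set us \<subseteq> items I" "u \<in> items I"
  shows "length (filter (\<lambda>a. fst (snd a) = fst a + len u \<and> snd (snd a) = col u) (path_arcs i us)) = count_list us u"
  using assms
proof (induction us arbitrary: i)
  case Nil
  then show ?case using col_le_Q[of u] by auto
next
  case (Cons v us)
  then show ?case using item_eqI[of v u] by auto
qed

lemma packing_family_imp_af_feasible: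
  assumes P: "packing_family z P"
  shows "\<exists>x. af_feasible I x z"
proof -
  define path where "path k = path_arcs 0 (P k)" for k
  define x where "x a = (\<Sum>k<z. count_list (path k) a)" for a
  have pack: "packing (P k)" "P k \<noteq> []" if "k < z" for k
    using P that by (auto simp: packing_family_def)
  have "set (path k) \<subseteq> arcs I" if "k < z" for k
    unfolding path_def using pack[OF that] by (intro path_arcs_subset) (auto simp: packing_def)
  then have x_sum: "(\<Sum>a\<in>{(i, j, q) \<in> arcs I. \<phi> i j q}. x a)
      = (\<Sum>k<z. length (filter (\<lambda>a. \<phi> (fst a) (fst (snd a)) (snd (snd a))) (path k)))" for \<phi>
    unfolding x_def using sum_count_list_filter[OF finite_arcs]
    by (subst sum.swap) simp
  have "flow_constraints I x z"
    unfolding flow_constraints_def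
  proof
    fix v
    have "(\<Sum>k<z. length (filter (\<lambda>a. fst (snd a) = v) (path k)) + (if v = 0 then 1 else 0))
        = (\<Sum>k<z. length (filter (\<lambda>a. fst a = v) (path k)) + (if v = L then 1 else 0))"
      unfolding path_def using pack
      by (intro sum.cong refl path_arcs_flow) (auto simp: packing_def)
    then show "int (\<Sum>a\<in>{(i, j, q) \<in> arcs I. j = v}. x a)
          - int (\<Sum>a\<in>{(i, j, q) \<in> arcs I. i = v}. x a)
        = (if v = 0 then - int z else if v = L then int z else 0)"
      unfolding x_sum using L_pos by (auto simp: sum.distrib simp del: of_nat_sum split: if_splits)
  qed
  moreover have "color_constraints I x"
    unfolding color_constraints_def
  proof (intro ballI)
    fix v p assume v: "v \<in> {1..L - 1}" and p: "p \<in> {1..Q}"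
    have "length (filter (\<lambda>a. fst (snd a) = v \<and> snd (snd a) = p) (path k))
      \<le> length (filter (\<lambda>a. fst a = v \<and> snd (snd a) \<in> {1..Q + 1} - {p}) (path k))" if "k < z" for k
    proof -
      have "hd (P k) \<in> items I"
        using pack[OF that] hd_in_set[of "P k"] by (auto simp: packing_def)
      then have "col (hd (P k)) \<noteq> 0"
        using col_ge_1 by fastforce
      then show ?thesis
        using path_arcs_color[of "P k" 0 0 v p] pack[OF that] v p
        by (auto simp: packing_def path_def)
    qed
    then show "(\<Sum>a\<in>{(i, j, q) \<in> arcs I. j = v \<and> q = p}. x a)
        \<le> (\<Sum>a\<in>{(i, j, q) \<in> arcs I. i = v \<and> q \<in> {1..Q + 1} - {p}}. x a)"
      unfolding x_sum by (intro sum_mono) simp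
  qed
  moreover have "demand_constraints I x"
    unfolding demand_constraints_def
  proof
    fix u assume u: "u \<in> items I"
    have "length (filter (\<lambda>a. fst (snd a) = fst a + len u \<and> snd (snd a) = col u) (path k)) = count_list (P k) u"
      if "k < z" for k
      unfolding path_def using pack[OF that] u
      by (intro path_arcs_demand) (auto simp: packing_def)
    then show "(\<Sum>a\<in>{(i, j, q) \<in> arcs I. j = i + len u \<and> q = col u}. x a) = item_demand I u"
      unfolding x_sum using P u by (simp add: packing_family_def)
  qed
  ultimately show ?thesis by (auto simp: af_feasible_def)
qed

section \<open>From flows to packings: the sweep over the vertices\<close>

text \<open>Extension by zero, because \<open>x\<close> is arbitrary outside the arc set. Sums can
  then run over all sources without testing whether the arc exists.\<close>

definition on_arcs :: "(arc \<Rightarrow> nat) \<Rightarrow> arc \<Rightarrow> nat" where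
  "on_arcs x a = (if a \<in> arcs I then x a else 0)"

text \<open>Among the arcs entering a fixed vertex in a fixed color, or those of fixed length and
  color, the source determines the arc. Summing by source is the form in which the sweep accumulates
  flow.\<close>

lemma sum_arcs_eq_sum_sources:
  assumes "\<And>i. fst (g i) = i"
    and "\<And>i j q. (i, j, q) \<in> arcs I \<Longrightarrow> \<phi> i j q \<longleftrightarrow> i < n \<and> g i = (i, j, q)"
  shows "(\<Sum>a\<in>{(i, j, q) \<in> arcs I. \<phi> i j q}. x a) = (\<Sum>i<n. on_arcs x (g i))"
proof -
  have "{(i, j, q). (i, j, q) \<in> arcs I \<and> \<phi> i j q} = g ` {i \<in> {..<n}. g i \<in> arcs I}" (is "?S = ?T")
  proof (intro equalityI subsetI)
    fix a assume "a \<in> ?S"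
    then have "fst a < n" "g (fst a) = a" "a \<in> arcs I"
      using assms(2) by auto
    then show "a \<in> ?T" by (intro rev_image_eqI[of "fst a"]) auto
  next
    fix a assume "a \<in> ?T"
    then obtain i where "i < n" "a = g i" "a \<in> arcs I" by blast
    moreover obtain j q where "g i = (i, j, q)"
      using assms(1)[of i] by (cases "g i") auto
    ultimately show "a \<in> ?S" using assms(2) by auto
  qed
  moreover have "inj_on g {i \<in> {..<n}. g i \<in> arcs I}"
    by (rule inj_on_inverseI[of _ fst]) (rule assms(1))
  ultimately have "(\<Sum>a\<in>{(i, j, q) \<in> arcs I. \<phi> i j q}. x a)
      = (\<Sum>i\<in>{i \<in> {..<n}. g i \<in> arcs I}. x (g i))"
    by (simp add: sum.reindex)
  also have "\<dots> = (\<Sum>i<n. on_arcs x (g i))"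
    unfolding on_arcs_def by (rule sum.inter_filter) simp
  finally show ?thesis .
qed

text \<open>Bins are built from the bottom up but stored with the most recently added item first.
  The value 0 for the empty list is not a color.\<close>
definition last_color :: "nat list \<Rightarrow> nat" where
  "last_color us = (case us of [] \<Rightarrow> 0 | u # _ \<Rightarrow> col u)"

text \<open>The invariant of the sweep: the flow on the item arcs leaving vertices below \<open>v\<close> has been
  distributed over \<open>z\<close> partial bins. A bin that took a loss arc keeps its load below \<open>v\<close>.\<close>
definition partial_bins :: "(arc \<Rightarrow> nat) \<Rightarrow> nat \<Rightarrow> nat \<Rightarrow> (nat \<Rightarrow> nat list) \<Rightarrow> bool" where
  "partial_bins x z v P \<longleftrightarrow>
     (\<forall>k<z. packing (P k) \<and> (P k = [] \<longrightarrow> v = 0)) \<and>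
     (\<forall>w q. v \<le> w \<longrightarrow> w < L \<longrightarrow>
        card {k. k < z \<and> sum_list (map len (P k)) = w \<and> last_color (P k) = q}
        = (if w = 0 \<and> q = 0 then z else 0) + (\<Sum>i<v. on_arcs x (i, w, q))) \<and>
     (\<forall>u\<in>items I. (\<Sum>k<z. count_list (P k) u) = (\<Sum>i<v. on_arcs x (i, i + len u, col u)))"

text \<open>At the start all \<open>z\<close> bins are empty, which the summand \<open>z\<close> at
  load 0 and color 0 of the invariant accounts for.\<close>

lemma partial_bins_0: "partial_bins x z 0 (\<lambda>_. [])"
  by (auto simp: partial_bins_def packing_def last_color_def)

lemma partial_bins_step:
  assumes x: "af_feasible I x z" and P: "partial_bins x z v P" and v: "v < L"
  shows "\<exists>P'. partial_bins x z (Suc v) P'"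
proof -
  define load where "load us = sum_list (map len us)" for us
  define E where "E = {k. k < z \<and> load (P k) = v}"
  define out where "out = {(i, j, q). (i, j, q) \<in> arcs I \<and> i = v}"
  \<comment> \<open>The units of flow leaving \<open>v\<close>: an arc \<open>a\<close> is split
    into \<open>x a\<close> units, each to serve one bin of \<open>E\<close>.\<close>
  define F where "F = (SIGMA a:out. {..<x a})"
  define arc_color where "arc_color a = snd (snd a)" for a :: arc
  have pack: "packing (P k)" "P k = [] \<Longrightarrow> v = 0" if "k < z" for k
    using P that by (auto simp: partial_bins_def)
  have count: "card {k. k < z \<and> load (P k) = w \<and> last_color (P k) = q}
      = (if w = 0 \<and> q = 0 then z else 0) + (\<Sum>i<v. on_arcs x (i, w, q))"
    if "v \<le> w" "w < L" for w q
    using P that by (simp add: partial_bins_def load_def)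
  have fin: "finite E" "finite out" "finite F"
    by (auto simp: E_def out_def F_def intro: finite_subset[OF _ finite_arcs])
  have color_out: "arc_color a \<in> {1..Q + 1}" if "a \<in> out" for a
    using that arcs_bounds by (auto simp: out_def arc_color_def)

  have entering: "(\<Sum>i<v. on_arcs x (i, v, q)) = (\<Sum>a\<in>{(i, j, q') \<in> arcs I. j = v \<and> q' = q}. x a)" for q
    by (rule sum_arcs_eq_sum_sources[symmetric]) (auto dest: arcs_bounds)
  have color_E: "card {k \<in> E. last_color (P k) = q}
      = (if v = 0 \<and> q = 0 then z else 0) + (\<Sum>a\<in>{(i, j, q') \<in> arcs I. j = v \<and> q' = q}. x a)" for q
    using count[of v q] v by (simp add: E_def conj_assoc entering)
  have card_F: "card {e \<in> F. \<phi> (fst e)} = (\<Sum>a\<in>{a \<in> out. \<phi> a}. x a)" for \<phi>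
  proof -
    have "{e \<in> F. \<phi> (fst e)} = (SIGMA a:{a \<in> out. \<phi> a}. {..<x a})"
      by (auto simp: F_def)
    then show ?thesis using fin by (simp add: card_SigmaI)
  qed

  have "card E = card F"
  proof -
    have "last_color (P k) \<le> Q" if "k \<in> E" for k
      using pack(1)[of k] that col_le_Q
      by (auto simp: E_def packing_def last_color_def split: list.splits)
    then have "card E = (\<Sum>q\<le>Q. card {k \<in> E. last_color (P k) = q})"
      using sum.group[of E "{..Q}" "\<lambda>k. last_color (P k)" "\<lambda>_. 1::nat"] fin by force
    also have "\<dots> = (if v = 0 then z else 0)
        + (\<Sum>q\<le>Q. \<Sum>a\<in>{(i, j, q') \<in> arcs I. j = v \<and> q' = q}. x a)"
      by (auto simp: color_E sum.distrib)
    also have "(\<Sum>q\<le>Q. \<Sum>a\<in>{(i, j, q') \<in> arcs I. j = v \<and> q' = q}. x a)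
        = (\<Sum>a\<in>{(i, j, q') \<in> arcs I. j = v}. x a)" (is "?l = sum x ?in")
    proof -
      have "finite ?in" by (auto intro: finite_subset[OF _ finite_arcs])
      \<comment> \<open>Loss arcs enter only \<open>L\<close>, and \<open>v < L\<close>.\<close>
      moreover have "arc_color ` ?in \<subseteq> {..Q}"
        using v col_le_Q by (auto simp: arcs_iff arc_color_def)
      ultimately have "(\<Sum>q\<le>Q. sum x {a \<in> ?in. arc_color a = q}) = sum x ?in"
        by (intro sum.group) auto
      moreover have "{a \<in> ?in. arc_color a = q} = {(i, j, q'). (i, j, q') \<in> arcs I \<and> j = v \<and> q' = q}" for q
        by (auto simp: arc_color_def)
      ultimately show ?thesis by simp
    qed
    \<comment> \<open>Flow conservation; at vertex 0 the \<open>z\<close> empty bins take the place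
      of the inflow.\<close>
    also have "(if v = 0 then z else 0) + sum x ?in = sum x out"
    proof -
      have "int (sum x ?in) - int (sum x out)
          = (if v = 0 then - int z else if v = L then int z else 0)"
        using x v unfolding af_feasible_def flow_constraints_def out_def by auto
      then show ?thesis using v by (auto simp del: of_nat_sum split: if_splits)
    qed
    also have "\<dots> = card F" using card_F[of "\<lambda>_. True"] by simp
    finally show ?thesis .
  qed
  moreover have "card {k \<in> E. last_color (P k) = q} \<le> card {e \<in> F. arc_color (fst e) \<noteq> q}" for q
  proof -
    \<comment> \<open>The value 0 marks an empty bin and clashes with no arc, so equal cardinalities
      suffice. For a color at an inner vertex the color constraint gives the bound. In the remaining
      case no arc enters \<open>v\<close> in color \<open>q\<close>, hence no bin of
      \<open>E\<close> ends in it.\<close>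
    consider "q = 0" | "q \<in> {1..Q}" "v > 0" | "q > 0" "q > Q \<or> v = 0"
      by (cases "q = 0"; cases "q \<le> Q"; cases "v = 0") auto
    then show ?thesis
    proof cases
      case 1
      have "arc_color (fst e) \<noteq> q" if "e \<in> F" for e
        using color_out[of "fst e"] that 1 by (auto simp: F_def)
      then have "{e \<in> F. arc_color (fst e) \<noteq> q} = F" by blast
      moreover have "card {k \<in> E. last_color (P k) = q} \<le> card E"
        using fin by (intro card_mono) auto
      ultimately show ?thesis using \<open>card E = card F\<close> by simp
    next
      case 2
      have "{a \<in> out. arc_color a \<noteq> q}
          = {(i, j, q'). (i, j, q') \<in> arcs I \<and> i = v \<and> q' \<in> {1..Q + 1} - {q}}"
        using color_out by (auto simp: out_def arc_color_def)
      then show ?thesis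
        using x 2 v unfolding card_F[of "\<lambda>a. arc_color a \<noteq> q"] color_E
        by (auto simp: af_feasible_def color_constraints_def)
    next
      case 3
      have "(i, v, q) \<notin> arcs I" for i
        using 3 v arcs_bounds(1)[of i v q] by (auto simp: arcs_iff dest: col_le_Q)
      then have "{(i, j, q'). (i, j, q') \<in> arcs I \<and> j = v \<and> q' = q} = {}" by auto
      then have "card {k \<in> E. last_color (P k) = q} = 0"
        unfolding color_E using 3 by (simp only:) simp
      then show ?thesis by simp
    qed
  qed
  ultimately obtain f where f: "bij_betw f E F"
    and f_color: "\<And>k. k \<in> E \<Longrightarrow> arc_color (fst (f k)) \<noteq> last_color (P k)"
    using ex_bij_betw_avoiding_label[of E F "\<lambda>k. last_color (P k)" "\<lambda>e. arc_color (fst e)"] fin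
    by auto

  define arc where "arc k = fst (f k)" for k
  have arc_out: "arc k \<in> out" if "k \<in> E" for k
    using bij_betwE[OF f] that by (force simp: arc_def F_def)
  have card_arc: "card {k \<in> E. arc k = (v, a)} = on_arcs x (v, a)" for a
  proof -
    have "bij_betw f {k \<in> E. arc k = (v, a)} {e \<in> F. fst e = (v, a)}"
      using f by (auto simp: bij_betw_def arc_def inj_on_def)
    then have "card {k \<in> E. arc k = (v, a)} = (\<Sum>a\<in>{b \<in> out. b = (v, a)}. x a)"
      using card_F[of "\<lambda>b. b = (v, a)"] by (simp add: bij_betw_same_card)
    also have "{b \<in> out. b = (v, a)} = (if (v, a) \<in> arcs I then {(v, a)} else {})"
      by (cases a) (auto simp: out_def)
    finally show ?thesis by (simp add: on_arcs_def)
  qed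
  \<comment> \<open>The bins matched with an item arc. The others in \<open>E\<close> drew a loss
    arc and stay as they are from now on.\<close>
  define E' where "E' = {k \<in> E. arc_color (arc k) \<le> Q}"
  have "\<exists>u. u \<in> items I \<and> arc k = (v, v + len u, col u)" if "k \<in> E'" for k
    using that arc_out[of k] by (auto simp: E'_def out_def arcs_iff arc_color_def)
  then obtain item where arc_eq: "\<And>k. k \<in> E' \<Longrightarrow> arc k = (v, v + len (item k), col (item k))"
    and item_items: "\<And>k. k \<in> E' \<Longrightarrow> item k \<in> items I"
    by metis
  define P' where "P' k = (if k \<in> E' then item k # P k else P k)" for k

  have "packing (P' k)" if "k < z" for k
  proof (cases "k \<in> E'")
    case True
    have "v + len (item k) \<le> L"
      using arc_out[of k] arc_eq[OF True] True arcs_bounds(3) by (auto simp: E'_def out_def)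
    moreover have "col (item k) \<noteq> last_color (P k)"
      using f_color[of k] arc_eq[OF True] True by (auto simp: E'_def arc_def arc_color_def)
    ultimately show ?thesis
      using pack(1)[OF that] item_items[OF True] True
      by (auto simp: packing_def P'_def E'_def E_def load_def last_color_def successively_Cons
          split: list.splits)
  qed (use pack that in \<open>simp add: P'_def\<close>)
  moreover have "P' k \<noteq> []" if "k < z" for k
  proof
    assume "P' k = []"
    then have "P k = []" "k \<notin> E'" by (auto simp: P'_def split: if_splits)
    \<comment> \<open>An empty bin can only occur at vertex 0, and there every leaving arc is an
      item arc, so the bin receives an item.\<close>
    then have "v = 0" "k \<in> E" using pack(2)[OF that] that by (auto simp: E_def load_def)
    then have "arc_color (arc k) \<le> Q"
      using arc_out[of k] col_le_Q by (auto simp: out_def arcs_iff arc_color_def)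
    then show False using \<open>k \<in> E\<close> \<open>k \<notin> E'\<close> by (simp add: E'_def)
  qed
  moreover have "card {k. k < z \<and> load (P' k) = w \<and> last_color (P' k) = q}
      = (if w = 0 \<and> q = 0 then z else 0) + (\<Sum>i<Suc v. on_arcs x (i, w, q))"
    if w: "Suc v \<le> w" "w < L" for w q
  proof -
    \<comment> \<open>As \<open>w < L\<close>, an arc ending at \<open>w\<close> is no loss arc, so
      a bin matched with it does receive an item.\<close>
    have *: "k \<in> E' \<and> v + len (item k) = w \<and> col (item k) = q
        \<longleftrightarrow> k \<in> E \<and> arc k = (v, w, q)" for k
      using arc_eq[of k] arc_out[of k] w col_le_Q
      by (fastforce simp: E'_def arc_color_def out_def arcs_iff)
    have "k < z \<and> load (P' k) = w \<and> last_color (P' k) = q \<longleftrightarrow>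
        (k < z \<and> load (P k) = w \<and> last_color (P k) = q) \<or> (k \<in> E \<and> arc k = (v, w, q))" for k
    proof (cases "k \<in> E'")
      case True
      then have "k < z" "load (P k) = v" by (auto simp: E'_def E_def)
      moreover have "load (P' k) = v + len (item k)" "last_color (P' k) = col (item k)"
        using True \<open>load (P k) = v\<close> by (auto simp: P'_def load_def last_color_def)
      ultimately show ?thesis using *[of k] True w by simp
    next
      case False
      then show ?thesis using *[of k] by (auto simp: P'_def)
    qed
    then have "{k. k < z \<and> load (P' k) = w \<and> last_color (P' k) = q}
        = {k. k < z \<and> load (P k) = w \<and> last_color (P k) = q} \<union> {k \<in> E. arc k = (v, w, q)}"
      by blast
    moreover have "{k. k < z \<and> load (P k) = w \<and> last_color (P k) = q} \<inter> {k \<in> E. arc k = (v, w, q)} = {}"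
      using w by (auto simp: E_def)
    ultimately show ?thesis
      using count[of w q] w fin card_arc[of "(w, q)"] by (simp add: card_Un_disjoint)
  qed
  moreover have "(\<Sum>k<z. count_list (P' k) u) = (\<Sum>i<Suc v. on_arcs x (i, i + len u, col u))"
    if u: "u \<in> items I" for u
  proof -
    \<comment> \<open>Here it matters that different items differ in length or color: the arc alone
      reveals the item.\<close>
    have *: "k \<in> E' \<and> item k = u \<longleftrightarrow> k \<in> E \<and> arc k = (v, v + len u, col u)" for k
    proof
      assume k: "k \<in> E \<and> arc k = (v, v + len u, col u)"
      then have E': "k \<in> E'" using col_le_Q[OF u] by (simp add: E'_def arc_color_def)
      from k arc_eq[OF E'] have "len (item k) = len u" "col (item k) = col u" by auto
      then have "item k = u" by (rule item_eqI[OF item_items[OF E'] u])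
      with E' show "k \<in> E' \<and> item k = u" ..
    next
      assume k: "k \<in> E' \<and> item k = u"
      then have "arc k = (v, v + len u, col u)" using arc_eq by blast
      with k show "k \<in> E \<and> arc k = (v, v + len u, col u)" by (simp add: E'_def)
    qed
    have "(\<Sum>k<z. count_list (P' k) u)
        = (\<Sum>k<z. count_list (P k) u + (if k \<in> E' \<and> item k = u then 1 else 0))"
      by (intro sum.cong) (auto simp: P'_def)
    also have "\<dots> = (\<Sum>k<z. count_list (P k) u) + card {k \<in> E. arc k = (v, v + len u, col u)}"
    proof -
      have "{k \<in> {..<z}. k \<in> E \<and> arc k = (v, v + len u, col u)} = {k \<in> E. arc k = (v, v + len u, col u)}"
        by (auto simp: E_def)
      then show ?thesis by (simp add: * sum.distrib flip: sum.inter_filter)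
    qed
    finally show ?thesis
      using P u card_arc by (simp add: partial_bins_def)
  qed
  ultimately have "partial_bins x z (Suc v) P'"
    by (simp add: partial_bins_def load_def)
  then show ?thesis by (rule exI[of _ P'])
qed

text \<open>Every arc starts below \<open>L\<close>, so at \<open>v = L\<close> all item arcs have
  been distributed and the item counts of the invariant become the demands. As \<open>L > 0\<close>,
  no bin is left empty.\<close>

lemma af_feasible_imp_packing_family:
  assumes x: "af_feasible I x z"
  shows "\<exists>P. packing_family z P"
proof -
  have "v \<le> L \<Longrightarrow> \<exists>P. partial_bins x z v P" for v
  proof (induction v)
    case 0
    show ?case by (rule exI) (rule partial_bins_0)
  next
    case (Suc v)
    then obtain P where "partial_bins x z v P" by auto
    then show ?case using Suc.prems by (intro partial_bins_step[OF x]) auto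
  qed
  then obtain P where P: "partial_bins x z L P" by auto
  have "(\<Sum>k<z. count_list (P k) u) = item_demand I u" if u: "u \<in> items I" for u
  proof -
    have "(\<Sum>i<L. on_arcs x (i, i + len u, col u))
        = (\<Sum>a\<in>{(i, j, q) \<in> arcs I. j = i + len u \<and> q = col u}. x a)"
      by (rule sum_arcs_eq_sum_sources[symmetric]) (auto dest: arcs_bounds)
    then show ?thesis
      using P x u by (simp add: partial_bins_def af_feasible_def demand_constraints_def)
  qed
  with P L_pos have "packing_family z P"
    by (auto simp: partial_bins_def packing_family_def)
  then show ?thesis by (rule exI[of _ P])
qed

end

theorem theorem2:
  fixes I :: cbpp
  assumes "cbpp_instance I"
  shows "(\<forall>z::nat. (\<exists>B. cbpp_solution I B \<and> card B = z) \<longleftrightarrow> (\<exists>x. af_feasible I x z))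
    \<and> cbpp_opt I = af_opt I"
proof -
  interpret colored_bin_packing I by unfold_locales fact
  have iff: "(\<exists>B. cbpp_solution I B \<and> card B = z) \<longleftrightarrow> (\<exists>x. af_feasible I x z)" for z
    using solution_imp_packing_family packing_family_imp_solution
      packing_family_imp_af_feasible af_feasible_imp_packing_family by metis
  \<comment> \<open>Both optima are infima of the same set of attainable values, so they also agree
    when that set is empty.\<close>
  have "(\<lambda>B. enat (card B)) ` {B. cbpp_solution I B}
      = enat ` {z. \<exists>B. cbpp_solution I B \<and> card B = z}"
    by auto
  also have "\<dots> = (\<lambda>(x, z). enat z) ` {(x, z). af_feasible I x z}"
    unfolding iff by auto
  finally show ?thesis using iff by (simp add: cbpp_opt_def af_opt_def)
qed

end
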